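(* (Arbitrary vs. Arbitrary, upper bound.) For every $\varepsilon>0$ there is a constant $C_\varepsilon$ (depending only on $\varepsilon$) such that for every $n \ge 2$ and any two disjoint sets $\mathcal{A}, \mathcal{B} \subseteq \{0,1\}^n$, there is a first-order $\tau_{\mathsf{string}}$-sentence with at most $(1+\varepsilon)\frac{n}{\log(n)} + C_\varepsilon$ quantifiers that is true in $\mathbf{B}_w$ for every $w\in\mathcal{A}$ and false in $\mathbf{B}_{w'}$ for every $w'\in\mathcal{B}$.
   Context: $\tau_{\mathsf{string}} = \langle <, S; \mathsf{min}, \mathsf{max}\rangle$ with $<$ binary, $S$ unary, $\mathsf{min},\mathsf{max}$ constants. A string $w = w_1\cdots w_n \in \{0,1\}^n$ is encoded by the structure $\mathbf{B}_w$ with universe $\{1,\dots,n\}$, $<$ the usual order, $S = \{i : w_i = 1\}$, $\mathsf{min}=1$, $\mathsf{max}=n$. The number of quantifiers of a sentence is the number of quantifier occurrences. $\log$ is base 2. *)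

theory Defs
  imports Complex_Main
begin

datatype trm = Var nat | MinC | MaxC

datatype fm =
    Eq trm trm
  | Less trm trm
  | InS trm
  | Neg fm
  | Conj fm fm
  | Disj fm fm
  | Exists nat fm
  | Forall nat fm

primrec fv_trm :: "trm \<Rightarrow> nat set" where
  "fv_trm (Var x) = {x}"
| "fv_trm MinC = {}"
| "fv_trm MaxC = {}"

primrec fv :: "fm \<Rightarrow> nat set" where
  "fv (Eq s t) = fv_trm s \<union> fv_trm t"
| "fv (Less s t) = fv_trm s \<union> fv_trm t"
| "fv (InS t) = fv_trm t"
| "fv (Neg p) = fv p"
| "fv (Conj p q) = fv p \<union> fv q"
| "fv (Disj p q) = fv p \<union> fv q"
| "fv (Exists x p) = fv p - {x}"
| "fv (Forall x p) = fv p - {x}"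

definition sentence :: "fm \<Rightarrow> bool" where
  "sentence p \<longleftrightarrow> fv p = {}"

text \<open>The total number of occurrences of quantifiers, not the nesting depth.\<close>

primrec num_quantifiers :: "fm \<Rightarrow> nat" where
  "num_quantifiers (Eq s t) = 0"
| "num_quantifiers (Less s t) = 0"
| "num_quantifiers (InS t) = 0"
| "num_quantifiers (Neg p) = num_quantifiers p"
| "num_quantifiers (Conj p q) = num_quantifiers p + num_quantifiers q"
| "num_quantifiers (Disj p q) = num_quantifiers p + num_quantifiers q"
| "num_quantifiers (Exists x p) = Suc (num_quantifiers p)"
| "num_quantifiers (Forall x p) = Suc (num_quantifiers p)"

record 'a string_structure =
  universe :: "'a set"
  less_rel :: "'a \<Rightarrow> 'a \<Rightarrow> bool"
  S_set :: "'a set"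
  min_elem :: 'a
  max_elem :: 'a

primrec eval_trm :: "'a string_structure \<Rightarrow> (nat \<Rightarrow> 'a) \<Rightarrow> trm \<Rightarrow> 'a" where
  "eval_trm M \<sigma> (Var x) = \<sigma> x"
| "eval_trm M \<sigma> MinC = min_elem M"
| "eval_trm M \<sigma> MaxC = max_elem M"

primrec sat :: "'a string_structure \<Rightarrow> (nat \<Rightarrow> 'a) \<Rightarrow> fm \<Rightarrow> bool" where
  "sat M \<sigma> (Eq s t) \<longleftrightarrow> eval_trm M \<sigma> s = eval_trm M \<sigma> t"
| "sat M \<sigma> (Less s t) \<longleftrightarrow> less_rel M (eval_trm M \<sigma> s) (eval_trm M \<sigma> t)"
| "sat M \<sigma> (InS t) \<longleftrightarrow> eval_trm M \<sigma> t \<in> S_set M"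
| "sat M \<sigma> (Neg p) \<longleftrightarrow> \<not> sat M \<sigma> p"
| "sat M \<sigma> (Conj p q) \<longleftrightarrow> sat M \<sigma> p \<and> sat M \<sigma> q"
| "sat M \<sigma> (Disj p q) \<longleftrightarrow> sat M \<sigma> p \<or> sat M \<sigma> q"
| "sat M \<sigma> (Exists x p) \<longleftrightarrow> (\<exists>a\<in>universe M. sat M (\<sigma>(x := a)) p)"
| "sat M \<sigma> (Forall x p) \<longleftrightarrow> (\<forall>a\<in>universe M. sat M (\<sigma>(x := a)) p)"

text \<open>Only used for sentences, where by the coincidence lemma below the choice of the
  assignment is irrelevant (the universe being nonempty).\<close>

definition true_in :: "'a string_structure \<Rightarrow> fm \<Rightarrow> bool" where
  "true_in M p \<longleftrightarrow> (\<forall>\<sigma>. range \<sigma> \<subseteq> universe M \<longrightarrow> sat M \<sigma> p)"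

text \<open>The encoding of a string as a structure: positions are counted from 1, whereas list
  indices start at 0.\<close>

definition string_struct :: "bool list \<Rightarrow> nat string_structure" where
  "string_struct w =
     \<lparr>universe = {1..length w},
      less_rel = (\<lambda>i j. i < j),
      S_set = {i \<in> {1..length w}. w ! (i - 1)},
      min_elem = 1,
      max_elem = length w\<rparr>"

lemma eval_trm_cong:
  "(\<And>x. x \<in> fv_trm t \<Longrightarrow> \<sigma> x = \<tau> x) \<Longrightarrow> eval_trm M \<sigma> t = eval_trm M \<tau> t"
  by (cases t) auto

lemma sat_cong:
  "(\<And>x. x \<in> fv p \<Longrightarrow> \<sigma> x = \<tau> x) \<Longrightarrow> sat M \<sigma> p = sat M \<tau> p"
proof (induction p arbitrary: \<sigma> \<tau>)
  case (Eq s t)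
  then show ?case using eval_trm_cong[of s \<sigma> \<tau> M] eval_trm_cong[of t \<sigma> \<tau> M] by simp
next
  case (Less s t)
  then show ?case using eval_trm_cong[of s \<sigma> \<tau> M] eval_trm_cong[of t \<sigma> \<tau> M] by simp
next
  case (InS t)
  then show ?case using eval_trm_cong[of t \<sigma> \<tau> M] by simp
next
  case (Neg p)
  have "sat M \<sigma> p = sat M \<tau> p"
    by (rule Neg.IH) (simp add: Neg.prems)
  then show ?case by simp
next
  case (Conj p q)
  have "sat M \<sigma> p = sat M \<tau> p"
    by (rule Conj.IH(1)) (simp add: Conj.prems)
  moreover have "sat M \<sigma> q = sat M \<tau> q"
    by (rule Conj.IH(2)) (simp add: Conj.prems)
  ultimately show ?case by simp
next
  case (Disj p q)
  have "sat M \<sigma> p = sat M \<tau> p"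
    by (rule Disj.IH(1)) (simp add: Disj.prems)
  moreover have "sat M \<sigma> q = sat M \<tau> q"
    by (rule Disj.IH(2)) (simp add: Disj.prems)
  ultimately show ?case by simp
next
  case (Exists x p)
  have "sat M (\<sigma>(x := a)) p = sat M (\<tau>(x := a)) p" for a
    by (rule Exists.IH) (simp add: Exists.prems)
  then show ?case by simp
next
  case (Forall x p)
  have "sat M (\<sigma>(x := a)) p = sat M (\<tau>(x := a)) p" for a
    by (rule Forall.IH) (simp add: Forall.prems)
  then show ?case by simp
qed

lemma true_in_sentence_iff:
  assumes "sentence p" and "range \<sigma> \<subseteq> universe M"
  shows "true_in M p \<longleftrightarrow> sat M \<sigma> p"
proof -
  have "sat M \<tau> p = sat M \<sigma> p" for \<tau>
    by (rule sat_cong) (use assms in \<open>simp add: sentence_def\<close>)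
  then show ?thesis
    using assms by (auto simp: true_in_def)
qed

end

theory Submission
  imports Defs "HOL-Library.FuncSet" "HOL-Real_Asymp.Real_Asymp"
begin

text \<open>The sentence is \<open>\<exists>c\<^sub>0\<dots>c\<^sub>t \<exists>x\<^sub>1\<dots>x\<^sub>m \<forall>z\<^sub>0\<dots>z\<^sub>K. \<phi>\<close> with \<open>\<phi>\<close> quantifier-free, so that
  only the lengths of the three blocks count. The \<open>c\<^sub>i\<close> are markers at distance \<open>K\<close>. Every
  \<open>x\<^sub>j\<close> equals one of \<open>t\<close> markers, so the \<open>x\<^sub>j\<close> can name every string as soon as
  \<open>t ^ m \<ge> 2 ^ n\<close>. The \<open>z\<^sub>k\<close> enumerate the positions between two consecutive markers: they
  refute gaps that are too long, hence misplaced markers, and they compare the letters of the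
  structure with those of the string named by the \<open>x\<^sub>j\<close>. For \<open>K\<close> about \<open>(log n)\<^sup>2\<close> both \<open>t\<close>
  and \<open>K\<close> are \<open>o(n / log n)\<close>, while \<open>log t \<sim> log n\<close> makes \<open>m \<sim> n / log n\<close> sufficient.\<close>

subsection \<open>Quantifier blocks and atomic types\<close>

lemma sat_foldr_Exists:
  "sat M \<sigma> (foldr Exists vs p) \<longleftrightarrow>
    (\<exists>\<tau>. (\<forall>v\<in>set vs. \<tau> v \<in> universe M) \<and> (\<forall>v. v \<notin> set vs \<longrightarrow> \<tau> v = \<sigma> v) \<and> sat M \<tau> p)"
proof (induction vs arbitrary: \<sigma>)
  case Nil
  have "\<tau> = \<sigma>" if "\<forall>v. \<tau> v = \<sigma> v" for \<tau>
    using that by auto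
  then show ?case by auto
next
  case (Cons x vs)
  show ?case
  proof
    assume "sat M \<sigma> (foldr Exists (x # vs) p)"
    then obtain a \<tau> where "a \<in> universe M" "\<forall>v\<in>set vs. \<tau> v \<in> universe M"
      "\<forall>v. v \<notin> set vs \<longrightarrow> \<tau> v = (\<sigma>(x := a)) v" "sat M \<tau> p"
      by (auto simp: Cons.IH)
    then show "\<exists>\<tau>. (\<forall>v\<in>set (x # vs). \<tau> v \<in> universe M) \<and>
        (\<forall>v. v \<notin> set (x # vs) \<longrightarrow> \<tau> v = \<sigma> v) \<and> sat M \<tau> p"
      \<comment> \<open>If \<open>x\<close> is bound again in \<open>vs\<close>, the inner binding
        overrides \<open>a\<close>, and \<open>\<tau> x\<close> lies in the universe by the
        condition on \<open>vs\<close>; otherwise \<open>\<tau> x = a\<close>.\<close>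
      by (intro exI[of _ \<tau>]) (cases "x \<in> set vs"; auto)
  next
    assume "\<exists>\<tau>. (\<forall>v\<in>set (x # vs). \<tau> v \<in> universe M) \<and>
        (\<forall>v. v \<notin> set (x # vs) \<longrightarrow> \<tau> v = \<sigma> v) \<and> sat M \<tau> p"
    then obtain \<tau> where "\<forall>v\<in>set (x # vs). \<tau> v \<in> universe M"
      "\<forall>v. v \<notin> set (x # vs) \<longrightarrow> \<tau> v = \<sigma> v" "sat M \<tau> p"
      by blast
    then show "sat M \<sigma> (foldr Exists (x # vs) p)"
      by (auto simp: Cons.IH intro!: bexI[of _ "\<tau> x"] exI[of _ \<tau>])
  qed
qed

lemma sat_foldr_Forall:
  "sat M \<sigma> (foldr Forall vs p) \<longleftrightarrow>
    (\<forall>\<tau>. (\<forall>v\<in>set vs. \<tau> v \<in> universe M) \<and> (\<forall>v. v \<notin> set vs \<longrightarrow> \<tau> v = \<sigma> v) \<longrightarrow> sat M \<tau> p)"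
proof -
  have "sat M \<sigma> (foldr Forall vs p) \<longleftrightarrow> \<not> sat M \<sigma> (foldr Exists vs (Neg p))"
    by (induction vs arbitrary: \<sigma>) auto
  then show ?thesis
    by (auto simp: sat_foldr_Exists)
qed

lemma num_quantifiers_foldr [simp]:
  "num_quantifiers (foldr Exists vs p) = length vs + num_quantifiers p"
  "num_quantifiers (foldr Forall vs p) = length vs + num_quantifiers p"
  by (induction vs) auto

lemma fv_foldr [simp]:
  "fv (foldr Exists vs p) = fv p - set vs"
  "fv (foldr Forall vs p) = fv p - set vs"
  by (induction vs) auto

text \<open>Shannon expansion, one atom at a time: \<open>T\<close> lists the admissible truth
  patterns, and fixing the truth value of \<open>b\<close> leaves a set of patterns on the remaining
  atoms.\<close>

lemma boolean_combination_exists: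
  fixes F :: "fm set" and T :: "fm set set"
  assumes "finite F" and "\<And>a. a \<in> F \<Longrightarrow> num_quantifiers a = 0"
  shows "\<exists>p. num_quantifiers p = 0 \<and> fv p \<subseteq> (\<Union>a\<in>F. fv a) \<and>
    (\<forall>M :: 'a string_structure. \<forall>\<sigma>. sat M \<sigma> p \<longleftrightarrow> {a \<in> F. sat M \<sigma> a} \<in> T)"
  using assms
proof (induction F arbitrary: T rule: finite_induct)
  case empty
  show ?case
    by (rule exI[of _ "if {} \<in> T then Eq MinC MinC else Neg (Eq MinC MinC)"]) auto
next
  case (insert b F)
  \<comment> \<open>\<open>p\<close> serves the case that \<open>b\<close> is true, where a pattern
    \<open>X\<close> on \<open>F\<close> really stands for \<open>insert b X\<close>;
    \<open>q\<close> serves the case that \<open>b\<close> is false.\<close>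
  obtain p where p: "num_quantifiers p = 0" "fv p \<subseteq> (\<Union>a\<in>F. fv a)"
    "\<And>(M :: 'a string_structure) \<sigma>. sat M \<sigma> p \<longleftrightarrow> {a \<in> F. sat M \<sigma> a} \<in> {X. insert b X \<in> T}"
    using insert.IH[of "{X. insert b X \<in> T}"] insert.prems by auto
  obtain q where q: "num_quantifiers q = 0" "fv q \<subseteq> (\<Union>a\<in>F. fv a)"
    "\<And>(M :: 'a string_structure) \<sigma>. sat M \<sigma> q \<longleftrightarrow> {a \<in> F. sat M \<sigma> a} \<in> T"
    using insert.IH[of T] insert.prems by auto
  have split: "{a \<in> insert b F. sat M \<sigma> a} =
      (if sat M \<sigma> b then insert b {a \<in> F. sat M \<sigma> a} else {a \<in> F. sat M \<sigma> a})"
    for M :: "'a string_structure" and \<sigma>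
    by auto
  show ?case
    unfolding split using p q insert.prems
    by (intro exI[of _ "Disj (Conj b p) (Conj (Neg b) q)"]) auto
qed

definition terms_below :: "nat \<Rightarrow> trm set" where
  "terms_below N = insert MinC (insert MaxC (Var ` {..<N}))"

definition atoms_below :: "nat \<Rightarrow> fm set" where
  "atoms_below N = (\<lambda>(s, t). Eq s t) ` (terms_below N \<times> terms_below N)
    \<union> (\<lambda>(s, t). Less s t) ` (terms_below N \<times> terms_below N) \<union> InS ` terms_below N"

text \<open>The quantifier-free type of the tuple \<open>\<sigma> 0\<close>, ...,
  \<open>\<sigma> (N - 1)\<close>.\<close>

definition atomic_type :: "nat \<Rightarrow> 'a string_structure \<Rightarrow> (nat \<Rightarrow> 'a) \<Rightarrow> fm set" where
  "atomic_type N M \<sigma> = {a \<in> atoms_below N. sat M \<sigma> a}"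

text \<open>Finitely many atoms use only these variables, so the matrix of a sentence may be given
  as any set of types, however that set is described.\<close>

lemma formula_of_atomic_types:
  fixes T :: "fm set set"
  obtains p where "num_quantifiers p = 0" "fv p \<subseteq> {..<N}"
    "\<And>(M :: 'a string_structure) \<sigma>. sat M \<sigma> p \<longleftrightarrow> atomic_type N M \<sigma> \<in> T"
proof -
  have "finite (atoms_below N)"
    by (simp add: atoms_below_def terms_below_def)
  moreover have "num_quantifiers a = 0" if "a \<in> atoms_below N" for a
    using that by (auto simp: atoms_below_def)
  ultimately obtain p where p: "num_quantifiers p = 0" "fv p \<subseteq> (\<Union>a\<in>atoms_below N. fv a)"
    "\<And>(M :: 'a string_structure) \<sigma>. sat M \<sigma> p \<longleftrightarrow> {a \<in> atoms_below N. sat M \<sigma> a} \<in> T"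
    using boolean_combination_exists[of "atoms_below N" T] by blast
  have "(\<Union>a\<in>atoms_below N. fv a) \<subseteq> {..<N}"
    by (auto simp: atoms_below_def terms_below_def)
  with p that show thesis
    unfolding atomic_type_def by blast
qed

text \<open>What a type reveals: order, coincidence with the end points, and letters. Distances are
  not among it and have to be recovered by counting strict steps.\<close>

lemma atomic_type_string_eqD:
  assumes eq: "atomic_type N (string_struct w) \<sigma> = atomic_type N (string_struct w') \<tau>"
    and len: "length w = n" "length w' = n" and v: "v < N"
  shows "u < N \<Longrightarrow> \<sigma> u < \<sigma> v \<longleftrightarrow> \<tau> u < \<tau> v"
    and "\<sigma> v = 1 \<longleftrightarrow> \<tau> v = 1"
    and "\<sigma> v = n \<longleftrightarrow> \<tau> v = n"
    and "\<sigma> v \<in> {1..n} \<Longrightarrow> \<tau> v \<in> {1..n} \<Longrightarrow> w ! (\<sigma> v - 1) \<longleftrightarrow> w' ! (\<tau> v - 1)"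
proof -
  have sat_iff: "sat (string_struct w) \<sigma> a \<longleftrightarrow> sat (string_struct w') \<tau> a" if "a \<in> atoms_below N" for a
    using eq that by (auto simp: atomic_type_def)
  have mem: "Var v \<in> terms_below N" "MinC \<in> terms_below N" "MaxC \<in> terms_below N"
    using v by (auto simp: terms_below_def)
  show "\<sigma> u < \<sigma> v \<longleftrightarrow> \<tau> u < \<tau> v" if "u < N"
    using sat_iff[of "Less (Var u) (Var v)"] that v
    by (auto simp: string_struct_def atoms_below_def terms_below_def)
  show "\<sigma> v = 1 \<longleftrightarrow> \<tau> v = 1"
    using sat_iff[of "Eq (Var v) MinC"] mem by (auto simp: string_struct_def atoms_below_def)
  show "\<sigma> v = n \<longleftrightarrow> \<tau> v = n"
    using sat_iff[of "Eq (Var v) MaxC"] mem len by (auto simp: string_struct_def atoms_below_def)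
  show "w ! (\<sigma> v - 1) \<longleftrightarrow> w' ! (\<tau> v - 1)" if "\<sigma> v \<in> {1..n}" "\<tau> v \<in> {1..n}"
    using sat_iff[of "InS (Var v)"] mem len that by (auto simp: string_struct_def atoms_below_def)
qed

subsection \<open>Markers\<close>

text \<open>Over the naturals each strict step gains at least one; this turns order information into
  lower bounds on distances.\<close>

lemma strict_steps_gap:
  fixes f :: "nat \<Rightarrow> nat"
  assumes "\<And>k. k < d \<Longrightarrow> f k < f (Suc k)" and "j \<le> k" and "k \<le> d"
  shows "f j + (k - j) \<le> f k"
  using assms(2,3)
proof (induction k rule: dec_induct)
  case (step k)
  then show ?case using assms(1)[of k] by auto
qed simp

text \<open>Here \<open>c\<close> is the intended placement of the markers and \<open>c'\<close> an arbitrary one; \<open>match\<close> says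
  that no choice \<open>z'\<close> of positions distinguishes the two.\<close>

lemma markers_determine_string:
  fixes c c' :: "nat \<Rightarrow> nat" and K n t :: nat and P P' :: "nat \<Rightarrow> bool"
  defines "c \<equiv> (\<lambda>i. min (1 + i * K) n)"
  assumes K: "K \<ge> 1" and t: "n \<le> 1 + t * K"
    and c': "c' 0 = 1" "c' t = n" "\<And>i. i < t \<Longrightarrow> c' i \<le> c' (Suc i)" "\<And>i. i \<le> t \<Longrightarrow> c' i \<in> {1..n}"
    and match: "\<And>z'. (\<And>k. k \<le> K \<Longrightarrow> z' k \<in> {1..n}) \<Longrightarrow> \<exists>z.
        (\<forall>k\<le>K. \<forall>i\<le>t. (z' k < c' i \<longleftrightarrow> z k < c i) \<and> (c' i < z' k \<longleftrightarrow> c i < z k)) \<and>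
        (\<forall>k\<le>K. \<forall>l\<le>K. z' k < z' l \<longleftrightarrow> z k < z l) \<and>
        (\<forall>k\<le>K. P' (z' k) \<longleftrightarrow> P (z k))"
    and p: "p \<in> {1..n}"
  shows "P' p \<longleftrightarrow> P p"
proof -
  \<comment> \<open>The choice of \<open>z'\<close> walks right from marker \<open>i0\<close> in
    unit steps and rests at the next marker once it is reached.\<close>
  have enum: "\<exists>z. (\<forall>k\<le>K. \<forall>i\<le>t. (min (c' i0 + k) (c' (Suc i0)) < c' i \<longleftrightarrow> z k < c i) \<and>
          (c' i < min (c' i0 + k) (c' (Suc i0)) \<longleftrightarrow> c i < z k)) \<and>
        (\<forall>k\<le>K. \<forall>l\<le>K. min (c' i0 + k) (c' (Suc i0)) < min (c' i0 + l) (c' (Suc i0)) \<longleftrightarrow> z k < z l) \<and>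
        (\<forall>k\<le>K. P' (min (c' i0 + k) (c' (Suc i0))) \<longleftrightarrow> P (z k))" if "i0 < t" for i0
    using c'(4)[of i0] c'(4)[of "Suc i0"] that
    by (intro match[of "\<lambda>k. min (c' i0 + k) (c' (Suc i0))"]) auto
  \<comment> \<open>The walk makes \<open>d\<close> strict steps between two consecutive markers of
    \<open>c'\<close>, so its partner \<open>z\<close> makes \<open>d\<close> strict steps between
    those of \<open>c\<close>. Hence no gap of \<open>c'\<close> exceeds the corresponding gap of
    \<open>c\<close>; the sums avoid truncated subtraction.\<close>
  have gap: "c' (Suc i) - c' i \<le> K \<and> c' (Suc i) + c i \<le> c (Suc i) + c' i" if i: "i < t" for i
  proof -
    obtain z where z: "\<forall>k\<le>K. \<forall>j\<le>t. (min (c' i + k) (c' (Suc i)) < c' j \<longleftrightarrow> z k < c j) \<and>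
          (c' j < min (c' i + k) (c' (Suc i)) \<longleftrightarrow> c j < z k)"
        "\<forall>k\<le>K. \<forall>l\<le>K. min (c' i + k) (c' (Suc i)) < min (c' i + l) (c' (Suc i)) \<longleftrightarrow> z k < z l"
      using enum[OF i] by blast
    define d where "d = min K (c' (Suc i) - c' i)"
    have cc: "c' i \<le> c' (Suc i)" using c'(3) i .
    have z0: "c i \<le> z 0" using z(1)[rule_format, of 0 i] i cc by auto
    have "z k < z (Suc k)" if "k < d" for k
      using z(2)[rule_format, of k "Suc k"] that cc by (auto simp: d_def)
    from strict_steps_gap[of d z 0 d, OF this] z0 have zd: "c i + d \<le> z d" by auto
    have le: "z d \<le> c (Suc i)"
      using z(1)[rule_format, of d "Suc i"] i by (auto simp: d_def not_less[symmetric])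
    have "d = c' (Suc i) - c' i"
    proof (rule ccontr)
      \<comment> \<open>A gap longer than \<open>K\<close> would leave the walk short of the next
        marker after \<open>K\<close> steps. Then \<open>z K\<close> would be below
        \<open>c (Suc i)\<close>, which is at most \<open>c i + K\<close>, although \<open>K\<close>
        strict steps from \<open>c i\<close> were made.\<close>
      assume "d \<noteq> c' (Suc i) - c' i"
      then have d: "d = K" "c' i + K < c' (Suc i)" by (auto simp: d_def)
      then have "z K < c (Suc i)"
        using z(1)[rule_format, of K "Suc i"] i by auto
      moreover have "c (Suc i) \<le> c i + K" by (auto simp: c_def)
      ultimately show False using zd d by simp
    qed
    moreover have "d \<le> K" by (simp add: d_def)
    ultimately show ?thesis using zd le cc by auto
  qed
  have up: "c' j + c i \<le> c j + c' i" if "i \<le> j" "j \<le> t" for i j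
    using that
  proof (induction j rule: dec_induct)
    case (step k)
    then show ?case using gap[of k] by auto
  qed simp
  have "n \<ge> 1" using p by auto
  then have "c 0 = 1" "c t = n" using t by (auto simp: c_def)
  \<comment> \<open>The gaps of \<open>c'\<close> are at most those of \<open>c\<close>, while both
    sequences run from 1 to \<open>n\<close>; so all partial sums agree.\<close>
  then have c_eq: "c' i = c i" if "i \<le> t" for i
    using up[of 0 i] up[of i t] that c'(1,2) by auto
  show ?thesis
  \<comment> \<open>The position \<open>n\<close> is apart because \<open>(n - 1) div K\<close> may
    equal \<open>t\<close>, beyond the last gap; every smaller position lies in a gap with index
    below \<open>t\<close>.\<close>
  proof (cases "p = n")
    case False
    define i where "i = (p - 1) div K"
    define k where "k = (p - 1) mod K"
    have pk: "p = 1 + i * K + k" "k < K"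
      using p K by (auto simp: i_def k_def)
    have i: "i < t"
    proof (rule ccontr)
      assume "\<not> i < t"
      then have "t * K \<le> i * K" by simp
      then show False using pk p t False unfolding atLeastAtMost_iff by linarith
    qed
    define d where "d = c (Suc i) - c i"
    have ci: "c i = 1 + i * K" "c i + k < c (Suc i)" "c (Suc i) = c i + d" "d \<le> K"
      using pk p False by (auto simp: c_def d_def)
    obtain z where z: "\<forall>k\<le>K. \<forall>j\<le>t. (min (c' i + k) (c' (Suc i)) < c' j \<longleftrightarrow> z k < c j) \<and>
          (c' j < min (c' i + k) (c' (Suc i)) \<longleftrightarrow> c j < z k)"
        "\<forall>k\<le>K. \<forall>l\<le>K. min (c' i + k) (c' (Suc i)) < min (c' i + l) (c' (Suc i)) \<longleftrightarrow> z k < z l"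
        "\<forall>k\<le>K. P' (min (c' i + k) (c' (Suc i))) \<longleftrightarrow> P (z k)"
      using enum[OF i] by blast
    have cc': "c' i = c i" "c' (Suc i) = c i + d" using c_eq i ci by auto
    \<comment> \<open>With the markers in place, \<open>z\<close> makes \<open>d\<close> strict
      steps inside an interval of length \<open>d\<close>. This squeezes \<open>z k\<close> to
      \<open>c i + k\<close>, which is \<open>p\<close>.\<close>
    have step: "z l < z (Suc l)" if "l < d" for l
      using z(2)[rule_format, of l "Suc l"] that ci(4) cc' by auto
    have "c i \<le> z 0"
      using z(1)[rule_format, of 0 i] i cc' by auto
    moreover have "z d \<le> c i + d"
      using z(1)[rule_format, of d "Suc i"] i ci(3,4) cc' by auto
    moreover have "z 0 + (k - 0) \<le> z k" "z k + (d - k) \<le> z d"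
      using strict_steps_gap[of d z 0 k, OF step] strict_steps_gap[of d z k d, OF step] ci by auto
    ultimately have "z k = p" using pk ci by auto
    moreover have "min (c' i + k) (c' (Suc i)) = p" using cc' ci pk by auto
    ultimately show ?thesis using z(3)[rule_format, of k] pk by auto
  next
    case True
    \<comment> \<open>All \<open>z'\<close> are placed on the last marker, so the partner is neither
      below nor above \<open>c t = n\<close>.\<close>
    obtain z where "\<forall>i\<le>t. (n < c' i \<longleftrightarrow> z 0 < c i) \<and> (c' i < n \<longleftrightarrow> c i < z (0::nat))"
      "P' n \<longleftrightarrow> P (z 0)"
      using match[of "\<lambda>_. n"] \<open>n \<ge> 1\<close> by fastforce
    then show ?thesis using True c'(2) \<open>c t = n\<close> by (metis less_irrefl linorder_neqE_nat order_refl)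
  qed
qed

subsection \<open>The separating sentence\<close>

text \<open>By counting, the strings inject into the words of length \<open>m\<close> over
  \<open>t\<close> symbols; \<open>e w j\<close> will be the index of the marker on which the
  \<open>j\<close>-th naming variable stands.\<close>

lemma string_code_exists:
  assumes "2 ^ n \<le> t ^ m"
  obtains e :: "bool list \<Rightarrow> nat \<Rightarrow> nat" where
    "\<And>w j. length w = n \<Longrightarrow> j < m \<Longrightarrow> e w j < t"
    "\<And>w w'. length w = n \<Longrightarrow> length w' = n \<Longrightarrow> (\<And>j. j < m \<Longrightarrow> e w j = e w' j) \<Longrightarrow> w = w'"
proof -
  have fin: "finite {w :: bool list. length w = n}"
    using finite_lists_length_eq[of "UNIV :: bool set" n] by simp
  have "card {w :: bool list. length w = n} = 2 ^ n"
    using card_lists_length_eq[of "UNIV :: bool set" n] by simp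
  moreover have "card ({..<m} \<rightarrow>\<^sub>E {..<t}) = t ^ m"
    by (simp add: card_PiE)
  ultimately obtain e where e: "e ` {w :: bool list. length w = n} \<subseteq> {..<m} \<rightarrow>\<^sub>E {..<t}"
    "inj_on e {w :: bool list. length w = n}"
    using card_le_inj[OF fin, of "{..<m} \<rightarrow>\<^sub>E {..<t}"] assms by (auto simp: finite_PiE)
  show thesis
  proof
    show "e w j < t" if "length w = n" "j < m" for w j
      using e(1) that by (auto simp: PiE_def Pi_def)
    show "w = w'" if "length w = n" "length w' = n" "\<And>j. j < m \<Longrightarrow> e w j = e w' j" for w w'
    proof -
      have "e w \<in> {..<m} \<rightarrow>\<^sub>E {..<t}" "e w' \<in> {..<m} \<rightarrow>\<^sub>E {..<t}"
        using e(1) that by auto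
      then have "e w = e w'"
        using that(3) by (intro PiE_ext[of _ "{..<m}"]) auto
      then show ?thesis using e(2) that by (auto simp: inj_on_def)
    qed
  qed
qed

text \<open>If a string in \<open>B\<close> satisfied the sentence, all universal choices would be
  matched by one single string in \<open>A\<close>, and the markers would force the two to be equal.
  The count adds \<open>t + 1\<close> markers, \<open>m\<close> naming variables and
  \<open>K + 1\<close> universal ones, since a gap of length \<open>K\<close> has
  \<open>K + 1\<close> positions including both ends.\<close>

lemma separating_sentence_exists:
  fixes A B :: "bool list set"
  assumes n: "n \<ge> 1" and K: "K \<ge> 1"
    and code: "2 ^ n \<le> ((n - 1) div K + 1) ^ m"
    and A: "A \<subseteq> {w. length w = n}" and B: "B \<subseteq> {w. length w = n}" and disj: "A \<inter> B = {}"
  shows "\<exists>p. sentence p \<and> num_quantifiers p = (n - 1) div K + m + K + 3 \<and>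
    (\<forall>w\<in>A. true_in (string_struct w) p) \<and> (\<forall>w\<in>B. \<not> true_in (string_struct w) p)"
proof -
  \<comment> \<open>Variables up to \<open>t\<close> are the markers, the next \<open>m\<close> name
    the string, and those from \<open>E\<close> to \<open>N - 1\<close> are universal.\<close>
  define t where "t = (n - 1) div K + 1"
  define E where "E = t + 1 + m"
  define N where "N = E + K + 1"
  define c where "c = (\<lambda>i. min (1 + i * K) n)"
  have t_ge: "n \<le> 1 + t * K"
  proof -
    have "n - 1 = (n - 1) div K * K + (n - 1) mod K" by simp
    moreover have "(n - 1) mod K < K" using K by simp
    ultimately show ?thesis unfolding t_def add_mult_distrib by linarith
  qed
  have c_range: "c i \<in> {1..n}" for i using n by (auto simp: c_def)
  \<comment> \<open>Marker \<open>t\<close> is excluded: it is cut off at \<open>n\<close> and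
    coincides with marker \<open>t - 1\<close> when \<open>K\<close> divides \<open>n - 1\<close>.
    This is why the code has only \<open>t\<close> symbols.\<close>
  have c_inj: "i = j" if "c i = c j" "i < t" "j < t" for i j
  proof -
    have "1 + l * K \<le> n" if "l < t" for l
    proof -
      have "l * K \<le> (n - 1) div K * K" using that by (simp add: t_def)
      also have "\<dots> \<le> n - 1" by simp
      finally show ?thesis using n by simp
    qed
    from this[OF that(2)] this[OF that(3)] have "i * K = j * K" using that(1) by (simp add: c_def)
    then show ?thesis using K by simp
  qed
  obtain e :: "bool list \<Rightarrow> nat \<Rightarrow> nat" where e: "\<And>w j. length w = n \<Longrightarrow> j < m \<Longrightarrow> e w j < t"
    "\<And>w w'. length w = n \<Longrightarrow> length w' = n \<Longrightarrow> (\<And>j. j < m \<Longrightarrow> e w j = e w' j) \<Longrightarrow> w = w'"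
    using string_code_exists[OF code[folded t_def]] by blast
  define good where "good = (\<lambda>w \<sigma>. (\<forall>i\<le>t. \<sigma> i = c i) \<and> (\<forall>j<m. \<sigma> (t + 1 + j) = c (e w j)) \<and>
    (\<forall>v<N. \<sigma> v \<in> {1..n}))"
  \<comment> \<open>\<open>T\<close> collects the types realised by intended placements over strings
    in \<open>A\<close>, so truth on \<open>A\<close> is immediate and the work lies in falsity on
    \<open>B\<close>.\<close>
  define T where "T = {atomic_type N (string_struct w) \<sigma> | w \<sigma>. w \<in> A \<and> good w \<sigma>}"
  obtain q where q: "num_quantifiers q = 0" "fv q \<subseteq> {..<N}"
    "\<And>(M :: nat string_structure) \<sigma>. sat M \<sigma> q \<longleftrightarrow> atomic_type N M \<sigma> \<in> T"
    using formula_of_atomic_types[of N T] by blast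
  define p where "p = foldr Exists [0..<E] (foldr Forall [E..<N] q)"
  have sent: "sentence p"
    using q(2) by (auto simp: sentence_def p_def)
  have num: "num_quantifiers p = (n - 1) div K + m + K + 3"
  proof -
    have "num_quantifiers p = E + (N - E)"
      using q(1) by (simp add: p_def)
    also have "\<dots> = t + 1 + m + (K + 1)"
      unfolding N_def E_def by linarith
    finally show ?thesis by (simp add: t_def)
  qed
  have true_iff: "true_in (string_struct w) p \<longleftrightarrow>
      (\<exists>\<tau>. (\<forall>v\<in>{0..<E}. \<tau> v \<in> {1..n}) \<and> (\<forall>v. v \<notin> {0..<E} \<longrightarrow> \<tau> v = 1) \<and>
        (\<forall>\<rho>. (\<forall>v\<in>{E..<N}. \<rho> v \<in> {1..n}) \<and> (\<forall>v. v \<notin> {E..<N} \<longrightarrow> \<rho> v = \<tau> v) \<longrightarrow>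
          atomic_type N (string_struct w) \<rho> \<in> T))" if "length w = n" for w
  proof -
    have U: "universe (string_struct w) = {1..n}" using that by (simp add: string_struct_def)
    have "true_in (string_struct w) p \<longleftrightarrow> sat (string_struct w) (\<lambda>_. 1) p"
      using n by (intro true_in_sentence_iff sent) (auto simp: U)
    then show ?thesis
      by (simp only: p_def sat_foldr_Exists sat_foldr_Forall U q(3) set_upt)
  qed
  have true_A: "true_in (string_struct w) p" if w: "w \<in> A" for w
  proof -
    have len: "length w = n" using A w by auto
    define \<tau> where "\<tau> = (\<lambda>v. if v \<le> t then c v else if v < E then c (e w (v - (t + 1))) else 1)"
    have \<tau>: "\<forall>v\<in>{0..<E}. \<tau> v \<in> {1..n}" "\<forall>v. v \<notin> {0..<E} \<longrightarrow> \<tau> v = 1"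
      using c_range by (auto simp: \<tau>_def E_def)
    have "atomic_type N (string_struct w) \<rho> \<in> T"
      if \<rho>: "\<forall>v\<in>{E..<N}. \<rho> v \<in> {1..n}" "\<forall>v. v \<notin> {E..<N} \<longrightarrow> \<rho> v = \<tau> v" for \<rho>
    proof -
      have "\<rho> v \<in> {1..n}" if "v < N" for v
        using \<rho> \<tau>(1) that by (cases "v < E") (simp_all add: not_less del: atLeastAtMost_iff)
      moreover have "\<rho> i = c i" if "i \<le> t" for i
        using \<rho>(2) that by (simp add: \<tau>_def E_def)
      moreover have "\<rho> (t + 1 + j) = c (e w j)" if "j < m" for j
        using \<rho>(2) that by (simp add: \<tau>_def E_def)
      ultimately have "good w \<rho>" unfolding good_def by blast
      then show ?thesis using w unfolding T_def by blast
    qed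
    with \<tau> show ?thesis unfolding true_iff[OF len] by blast
  qed
  have false_B: "\<not> true_in (string_struct w') p" if w': "w' \<in> B" for w'
  proof
    have len': "length w' = n" using B w' by auto
    assume "true_in (string_struct w') p"
    then obtain \<tau> where \<tau>: "\<forall>v\<in>{0..<E}. \<tau> v \<in> {1..n}"
      and all: "\<forall>\<rho>. (\<forall>v\<in>{E..<N}. \<rho> v \<in> {1..n}) \<and> (\<forall>v. v \<notin> {E..<N} \<longrightarrow> \<rho> v = \<tau> v) \<longrightarrow>
          atomic_type N (string_struct w') \<rho> \<in> T"
      unfolding true_iff[OF len'] by (elim exE conjE) (rule that)
    \<comment> \<open>The existential choice \<open>\<tau>\<close> is fixed, and \<open>z\<close>
      supplies the values of the universal block.\<close>
    define ext where "ext = (\<lambda>z v. if E \<le> v \<and> v < N then z (v - E) else \<tau> v)"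
    have ext_E: "ext z v = \<tau> v" if "v < E" for z v using that by (simp add: ext_def)
    have ext_z: "ext z (E + k) = z k" if "k \<le> K" for z k using that by (simp add: ext_def N_def)
    have ext_range: "ext z v \<in> {1..n}" if "\<And>k. k \<le> K \<Longrightarrow> z k \<in> {1..n}" "v < N" for z v
    proof (cases "v < E")
      case True
      then show ?thesis using \<tau> by (auto simp: ext_E)
    next
      case False
      then have "v - E \<le> K" using that(2) by (auto simp: N_def)
      then show ?thesis using that False by (simp add: ext_def)
    qed
    have EN: "E \<le> N" by (simp add: N_def)
    have match: "\<exists>w \<sigma>. w \<in> A \<and> good w \<sigma> \<and>
        atomic_type N (string_struct w') (ext z) = atomic_type N (string_struct w) \<sigma>"
      if "\<And>k. k \<le> K \<Longrightarrow> z k \<in> {1..n}" for z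
    proof -
      have "atomic_type N (string_struct w') (ext z) \<in> T"
      proof (rule all[THEN spec, THEN mp, OF conjI])
        show "\<forall>v\<in>{E..<N}. ext z v \<in> {1..n}" using ext_range[OF that] by simp
        show "\<forall>v. v \<notin> {E..<N} \<longrightarrow> ext z v = \<tau> v" by (simp add: ext_def)
      qed
      then show ?thesis unfolding T_def by blast
    qed
    \<comment> \<open>Different \<open>z\<close> might be matched by different strings in
      \<open>A\<close>. But the naming variables and markers get their values from
      \<open>\<tau>\<close> alone, so the code of the matching string does not depend on
      \<open>z\<close>.\<close>
    have code_eq: "\<tau> (t + 1 + j) = \<tau> i \<longleftrightarrow> i = e w j"
      if "w \<in> A" "good w \<sigma>" "j < m" "i < t"
        "atomic_type N (string_struct w') (ext z) = atomic_type N (string_struct w) \<sigma>"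
      for w \<sigma> i j z
    proof -
      have len: "length w = n" using A that(1) by auto
      have lt: "i < E" "t + 1 + j < E" using that by (auto simp: E_def)
      then have ltN: "i < N" "t + 1 + j < N" using EN by auto
      have "\<tau> (t + 1 + j) < \<tau> i \<longleftrightarrow> \<sigma> (t + 1 + j) < \<sigma> i" "\<tau> i < \<tau> (t + 1 + j) \<longleftrightarrow> \<sigma> i < \<sigma> (t + 1 + j)"
        using atomic_type_string_eqD(1)[OF that(5) len' len ltN(1) ltN(2)]
          atomic_type_string_eqD(1)[OF that(5) len' len ltN(2) ltN(1)]
        by (simp_all only: ext_E[OF lt(1)] ext_E[OF lt(2)])
      then have "\<tau> (t + 1 + j) = \<tau> i \<longleftrightarrow> \<sigma> (t + 1 + j) = \<sigma> i"
        by linarith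
      also have "\<dots> \<longleftrightarrow> c (e w j) = c i"
        using that(2-4) by (simp add: good_def)
      also have "\<dots> \<longleftrightarrow> i = e w j"
        using c_inj that(4) e(1)[OF len that(3)] by auto
      finally show ?thesis .
    qed
    \<comment> \<open>Any \<open>z\<close> in range serves to single out \<open>w\<close>; the
      constant 1 is taken.\<close>
    obtain w \<sigma>0 where w: "w \<in> A" "good w \<sigma>0"
        "atomic_type N (string_struct w') (ext (\<lambda>_. 1)) = atomic_type N (string_struct w) \<sigma>0"
      using match[of "\<lambda>_. 1"] n by auto
    have len: "length w = n" using A w(1) by auto
    have match_w: "\<exists>\<sigma>. good w \<sigma> \<and>
        atomic_type N (string_struct w') (ext z) = atomic_type N (string_struct w) \<sigma>"
      if z: "\<And>k. k \<le> K \<Longrightarrow> z k \<in> {1..n}" for z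
    proof -
      obtain u \<sigma> where u: "u \<in> A" "good u \<sigma>"
          "atomic_type N (string_struct w') (ext z) = atomic_type N (string_struct u) \<sigma>"
        using match[of z, OF z] by blast
      have lenu: "length u = n" using A u(1) by auto
      have "u = w"
      proof (rule e(2)[OF lenu len])
        fix j assume j: "j < m"
        show "e u j = e w j"
          using code_eq[OF u(1,2) j e(1)[OF lenu j] u(3)] code_eq[OF w(1,2) j e(1)[OF lenu j] w(3)]
          by simp
      qed
      then show ?thesis using u by blast
    qed
    note w_iff = atomic_type_string_eqD[OF w(3) len' len]
    have \<sigma>0: "\<sigma>0 i = c i" if "i \<le> t" for i using w(2) that by (simp add: good_def)
    have tE: "i < E \<and> i < N" if "i \<le> t" for i using that EN by (auto simp: E_def)
    have "c 0 = 1" "c t = n" using n t_ge by (auto simp: c_def)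
    \<comment> \<open>The end points and the order of the markers are visible in the type and so
      pass from \<open>c\<close> to \<open>\<tau>\<close>.\<close>
    then have c': "\<tau> 0 = 1" "\<tau> t = n"
      using w_iff(2)[of 0] w_iff(3)[of t] tE \<sigma>0 by (auto simp: ext_E)
    have mono: "\<tau> i \<le> \<tau> (Suc i)" if "i < t" for i
    proof -
      have "c i \<le> c (Suc i)" by (auto simp: c_def)
      then show ?thesis
        using w_iff(1)[of i "Suc i"] tE[of i] tE[of "Suc i"] \<sigma>0 that by (simp add: ext_E not_less[symmetric])
    qed
    have letter: "w' ! (i - 1) \<longleftrightarrow> w ! (i - 1)" if "i \<in> {1..n}" for i
    proof (rule markers_determine_string[where c' = \<tau> and K = K and n = n and t = t and p = i
          and P' = "\<lambda>i. w' ! (i - 1)" and P = "\<lambda>i. w ! (i - 1)"])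
      show "i \<in> {1..n}" by fact
      show "\<tau> i \<in> {1..n}" if "i \<le> t" for i using \<tau> tE[OF that] by simp
      fix z' :: "nat \<Rightarrow> nat" assume z': "\<And>k. k \<le> K \<Longrightarrow> z' k \<in> {1..n}"
      then obtain \<sigma> where \<sigma>: "good w \<sigma>"
          "atomic_type N (string_struct w') (ext z') = atomic_type N (string_struct w) \<sigma>"
        using match_w[of z', OF z'] by blast
      note iff = atomic_type_string_eqD[OF \<sigma>(2) len' len]
      have kN: "E + k < N" if "k \<le> K" for k using that by (simp add: N_def)
      have \<sigma>c: "\<sigma> i = c i" if "i \<le> t" for i using \<sigma>(1) that by (simp add: good_def)
      have 1: "(z' k < \<tau> i \<longleftrightarrow> \<sigma> (E + k) < c i) \<and> (\<tau> i < z' k \<longleftrightarrow> c i < \<sigma> (E + k))"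
        if "k \<le> K" "i \<le> t" for k i
        using iff(1)[of i "E + k"] iff(1)[of "E + k" i] kN[OF that(1)] tE[OF that(2)] that
        by (simp add: ext_E ext_z \<sigma>c)
      have 2: "z' k < z' l \<longleftrightarrow> \<sigma> (E + k) < \<sigma> (E + l)" if "k \<le> K" "l \<le> K" for k l
        using iff(1)[of "E + l" "E + k"] kN that by (simp add: ext_z)
      have 3: "w' ! (z' k - 1) \<longleftrightarrow> w ! (\<sigma> (E + k) - 1)" if "k \<le> K" for k
      proof -
        have "\<sigma> (E + k) \<in> {1..n}" using \<sigma>(1) kN[OF that] by (auto simp: good_def)
        then show ?thesis
          using iff(4)[of "E + k"] kN[OF that] z'[OF that] by (simp add: ext_z that)
      qed
      show "\<exists>z. (\<forall>k\<le>K. \<forall>i\<le>t. (z' k < \<tau> i \<longleftrightarrow> z k < min (1 + i * K) n) \<and>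
            (\<tau> i < z' k \<longleftrightarrow> min (1 + i * K) n < z k)) \<and>
          (\<forall>k\<le>K. \<forall>l\<le>K. z' k < z' l \<longleftrightarrow> z k < z l) \<and>
          (\<forall>k\<le>K. w' ! (z' k - 1) \<longleftrightarrow> w ! (z k - 1))"
        using 1 2 3 unfolding c_def by (intro exI[of _ "\<lambda>k. \<sigma> (E + k)"]) blast
    qed (use K t_ge c' mono in auto)
    have "w' ! i \<longleftrightarrow> w ! i" if "i < n" for i
      using letter[of "Suc i"] that by simp
    then have "w' = w"
      using len len' by (intro nth_equalityI) auto
    then show False using w(1) w' disj by auto
  qed
  show ?thesis using sent num true_A false_B by blast
qed

subsection \<open>Choice of the parameters\<close>

text \<open>With \<open>K\<close> about \<open>(log n)^2\<close>, both \<open>n / K\<close> and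
  \<open>K\<close> are \<open>o(n / log n)\<close>, and \<open>log t\<close> is asymptotic to
  \<open>log n\<close>, so \<open>m = \<lceil>n / log t\<rceil>\<close> gives the leading
  term.\<close>

lemma parameters_exist:
  fixes \<epsilon> :: real
  assumes "\<epsilon> > 0"
  shows "eventually (\<lambda>n. \<exists>K m. K \<ge> 1 \<and> 2 ^ n \<le> ((n - 1) div K + 1) ^ m \<and>
    real ((n - 1) div K + m + K + 3) \<le> (1 + \<epsilon>) * (real n / log 2 (real n))) at_top"
proof -
  define L where "L = (\<lambda>n::nat. log 2 (real n))"
  \<comment> \<open>A majorant of the count free of rounding: its summands bound
    \<open>(n - 1) div K\<close>, \<open>m\<close>, \<open>K\<close> and 3 in turn. In the second,
    \<open>t\<close> is replaced by its lower bound; the inner summands \<open>+ 1\<close> after the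
    quotient and after \<open>L n ^ 2\<close> in the third absorb ceilings.\<close>
  define g where "g = (\<lambda>n::nat. real n / L n ^ 2 + (real n / log 2 (real n / (L n ^ 2 + 1)) + 1)
    + (L n ^ 2 + 1) + 3)"
  have "(\<lambda>n. g n / (real n / L n)) \<longlonglongrightarrow> 1"
    unfolding g_def L_def by real_asymp
  then have 1: "eventually (\<lambda>n. g n / (real n / L n) < 1 + \<epsilon>) at_top"
    by (rule order_tendstoD) (use assms in simp)
  \<comment> \<open>Makes the logarithm of the lower bound of \<open>t\<close> positive, as the
    divisions below require.\<close>
  have 2: "eventually (\<lambda>n. real n / (L n ^ 2 + 1) > 1) at_top"
    unfolding L_def by real_asymp
  have 3: "eventually (\<lambda>n. n \<ge> 2) (at_top :: nat filter)"
    by (rule eventually_ge_at_top)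
  show ?thesis
    using 1 2 3
  proof eventually_elim
    case (elim n)
    have L: "L n > 0" using elim by (simp add: L_def)
    define K where "K = nat \<lceil>L n ^ 2\<rceil>"
    define t where "t = (n - 1) div K + 1"
    define m where "m = nat \<lceil>real n / log 2 (real t)\<rceil>"
    have L2: "L n ^ 2 > 0" using L by simp
    have K1: "K \<ge> 1" using L2 by (simp add: K_def Suc_le_eq)
    have K: "L n ^ 2 \<le> real K" "real K \<le> L n ^ 2 + 1"
      using L2 unfolding K_def by linarith+
    have "real ((n - 1) div K) \<le> real (n - 1) / real K"
      by (rule of_nat_div_le_of_nat)
    also have "\<dots> \<le> real n / L n ^ 2"
      using K L2 by (intro frac_le) auto
    finally have t_up: "real ((n - 1) div K) \<le> real n / L n ^ 2" .
    have "n - 1 = (n - 1) div K * K + (n - 1) mod K" by simp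
    moreover have "(n - 1) mod K < K" using K1 by simp
    ultimately have "n \<le> t * K" using elim(3) unfolding t_def add_mult_distrib by linarith
    then have "real n \<le> real t * real K" by (metis of_nat_le_iff of_nat_mult)
    also have "\<dots> \<le> real t * (L n ^ 2 + 1)" using K by (intro mult_left_mono) auto
    finally have t_lo: "real n / (L n ^ 2 + 1) \<le> real t"
      using add_pos_pos[OF L2, of 1] by (simp add: pos_divide_le_eq)
    have log_pos: "0 < log 2 (real n / (L n ^ 2 + 1))" using elim(2) by simp
    have log_le: "log 2 (real n / (L n ^ 2 + 1)) \<le> log 2 (real t)"
      using t_lo elim(2) by (subst log_le_cancel_iff) auto
    have m_lo: "real n / log 2 (real t) \<le> real m"
      unfolding m_def by (rule real_nat_ceiling_ge)
    have "real m \<le> real n / log 2 (real t) + 1"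
      using log_pos log_le by (auto simp: m_def)
    also have "real n / log 2 (real t) \<le> real n / log 2 (real n / (L n ^ 2 + 1))"
      using log_pos log_le by (intro divide_left_mono) auto
    finally have m_up: "real m \<le> real n / log 2 (real n / (L n ^ 2 + 1)) + 1" by simp
    have "real n \<le> real m * log 2 (real t)"
      using m_lo log_pos log_le by (simp add: divide_simps split: if_splits)
    then have "2 powr real n \<le> 2 powr (real m * log 2 (real t))" by simp
    also have "\<dots> = (2 powr log 2 (real t)) powr real m"
      by (simp add: powr_powr mult.commute)
    also have "\<dots> = real t ^ m"
      using t_lo elim(2) by (simp add: powr_realpow)
    finally have "real (2 ^ n) \<le> real (t ^ m)" by (simp add: powr_realpow)
    then have code: "2 ^ n \<le> t ^ m" by (simp only: of_nat_le_iff)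
    have "real ((n - 1) div K + m + K + 3) \<le> g n"
      using t_up m_up K by (simp add: g_def)
    also have "\<dots> \<le> (1 + \<epsilon>) * (real n / L n)"
      using elim(1,3) L by (simp add: divide_simps split: if_splits)
    finally show ?case
      using K1 code unfolding t_def L_def by blast
  qed
qed

theorem theorem5p5:
  fixes \<epsilon> :: real
  assumes "\<epsilon> > 0"
  shows "\<exists>C :: real. \<forall>n :: nat. n \<ge> 2 \<longrightarrow>
    (\<forall>A B :: bool list set.
       A \<subseteq> {w. length w = n} \<and> B \<subseteq> {w. length w = n} \<and> A \<inter> B = {} \<longrightarrow>
       (\<exists>p. sentence p
          \<and> real (num_quantifiers p) \<le> (1 + \<epsilon>) * (real n / log 2 (real n)) + C
          \<and> (\<forall>w\<in>A. true_in (string_struct w) p)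
          \<and> (\<forall>w\<in>B. \<not> true_in (string_struct w) p)))"
proof -
  obtain n0 where n0: "\<And>n. n \<ge> n0 \<Longrightarrow> \<exists>K m. K \<ge> 1 \<and> 2 ^ n \<le> ((n - 1) div K + 1) ^ m \<and>
    real ((n - 1) div K + m + K + 3) \<le> (1 + \<epsilon>) * (real n / log 2 (real n))"
    using parameters_exist[OF assms] by (auto simp: eventually_at_top_linorder)
  \<comment> \<open>Below the threshold \<open>n0\<close>, which depends only on \<epsilon>, take
    \<open>K = 1\<close> and \<open>m = n\<close>: then \<open>t = n \<ge> 2\<close>, and the count
    \<open>2 * n + 3\<close> is absorbed by the constant \<open>2 * n0 + 3\<close>.\<close>
  have params: "\<exists>K m. K \<ge> 1 \<and> 2 ^ n \<le> ((n - 1) div K + 1) ^ m \<and>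
      real ((n - 1) div K + m + K + 3) \<le> (1 + \<epsilon>) * (real n / log 2 (real n)) + real (2 * n0 + 3)"
    if n: "n \<ge> 2" for n
  proof (cases "n \<ge> n0")
    case True
    then show ?thesis using n0[OF True] by (meson add_increasing2 of_nat_0_le_iff)
  next
    case False
    have "0 \<le> (1 + \<epsilon>) * (real n / log 2 (real n))"
      using assms n by simp
    moreover have "real ((n - 1) div 1 + n + 1 + 3) \<le> real (2 * n0 + 3)"
      using False n by simp
    moreover have "2 ^ n \<le> ((n - 1) div 1 + 1) ^ n"
      using n by (intro power_mono) auto
    ultimately show ?thesis
      by (intro exI[of _ 1] exI[of _ n]) auto
  qed
  show ?thesis
  proof (intro exI[of _ "real (2 * n0 + 3)"] allI impI)
    fix n :: nat and A B :: "bool list set"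
    assume n: "n \<ge> 2"
      and AB: "A \<subseteq> {w. length w = n} \<and> B \<subseteq> {w. length w = n} \<and> A \<inter> B = {}"
    obtain K m where Km: "K \<ge> 1" "2 ^ n \<le> ((n - 1) div K + 1) ^ m"
      "real ((n - 1) div K + m + K + 3) \<le> (1 + \<epsilon>) * (real n / log 2 (real n)) + real (2 * n0 + 3)"
      using params[OF n] by blast
    obtain p where "sentence p" "num_quantifiers p = (n - 1) div K + m + K + 3"
      "\<forall>w\<in>A. true_in (string_struct w) p" "\<forall>w\<in>B. \<not> true_in (string_struct w) p"
      using separating_sentence_exists[OF _ Km(1,2), of A B] n AB by auto
    then show "\<exists>p. sentence p
        \<and> real (num_quantifiers p) \<le> (1 + \<epsilon>) * (real n / log 2 (real n)) + real (2 * n0 + 3)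
        \<and> (\<forall>w\<in>A. true_in (string_struct w) p)
        \<and> (\<forall>w\<in>B. \<not> true_in (string_struct w) p)"
      using Km(3) by auto
  qed
qed

end
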